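(* Let $\mathscr{X}=L^2(0,1)$, let $\psi_1,\ldots,\psi_n$ be the periodic $P_1$ finite element hat functions on the equidistant grid of $(0,1)$ with step size $h=\frac1n$ for some $n\in\mathbb{N}$, and let $\mathcal{T}_i(p_i)\varphi=\varphi(\cdot-p_i)$ be the shift operator with periodic embedding. Then for $p_i\in[0,h)$ and $k,\ell\in\{1,\ldots,n\}$ (with the relations between $\ell$ and $k$ below understood modulo $n$) we obtain $$\langle\psi_k,\mathcal{T}_i(p_i)\psi_\ell\rangle_{\mathscr{X}}=\begin{cases}\frac{1}{h^2}\left(\frac23(h-p_i)^3+p_i(h-p_i)^2+p_ih(h-p_i)+\frac16p_i^3\right),&\text{if }\ell=k,\\ \frac{1}{6h^2}(h-p_i)^3,&\text{if }\ell=k+1,\\ \frac{1}{h^2}\left(\frac16(h-p_i)^3-\frac13p_i^3+h^2p_i\right),&\text{if }\ell=k-1,\\ \frac{1}{6h^2}p_i^3,&\text{if }\ell=k-2,\\ 0,&\text{otherwise},\end{cases}$$ and $$\left\langle\psi_k,\tfrac{\partial}{\partial p_i}\mathcal{T}_i(p_i)\psi_\ell\right\rangle_{\mathscr{X}}=\begin{cases}-\frac{1}{h^2}\left(2p_ih-\frac32p_i^2\right),&\text{if }\ell=k,\\ -\frac{1}{2h^2}(h-p_i)^2,&\text{if }\ell=k+1,\\ -\frac{1}{h^2}\left(2p_i^2-2hp_i-\frac12(h-p_i)^2\right),&\text{if }\ell=k-1,\\ \frac{1}{2h^2}p_i^2,&\text{if }\ell=k-2,\\ 0,&\text{otherwi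se}.\end{cases}$$
   Context: For $p\in\mathbb{R}$ and $\varphi\in L^2(0,1)$, $\varphi(\cdot-p)$ means: extend $\varphi$ to a $1$-periodic function on $\mathbb{R}$, shift by $p$, and restrict to $(0,1)$. The index $i$ only labels the transformation operator; the operator is the same periodic shift for every $i$. The derivative $\frac{\partial}{\partial p_i}\mathcal{T}_i(p_i)\psi_\ell$ is the derivative of the map $\mathbb{R}\to L^2(0,1)$, $p_i\mapsto\mathcal{T}_i(p_i)\psi_\ell$. The inner product $\langle\cdot,\cdot\rangle_{\mathscr{X}}$ is the standard one of $L^2(0,1)$. The hat functions on $(0,1)$ are, for $\ell=1,\ldots,n-1$, $\psi_\ell(x)=\frac{x-(\ell-1)h}{h}$ for $x\in((\ell-1)h,\ell h]$, $\psi_\ell(x)=\frac{(\ell+1)h-x}{h}$ for $x\in(\ell h,(\ell+1)h)$, and $\psi_\ell(x)=0$ otherwise; and $\psi_n(x)=\frac{x-(n-1)h}{h}$ for $x\in((n-1)h,nh]$, $\psi_n(x)=\frac{h-x}{h}$ for $x\in(0,h)$, and $\psi_n(x)=0$ otherwise. They discretize the space $H^1_{\mathrm{per}}(0,1)$ of $H^1(0,1)$ functions with equal values at $0$ and $1$. An index $m\notin\{1,\ldots,n\}$ is replaced by $((m-1)\bmod n)+1$.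
   Formalization: Proved only when at most one of ℓ=k, k+1, k−1, k−2 holds modulo n: all n≥4, n=3 except ℓ=k+1=k−2, no n≤2. Otherwise the cases overlap and the display fails: for n=2, ℓ=k+1=k−1, p=0 it gives h/6, but the true value is h/3. *)

theory Defs
  imports "HOL-Analysis.Analysis" "HOL-Number_Theory.Cong"
begin

section \<open>The real Hilbert space \<open>L\<^sup>2(0,1)\<close>\<close>

definition unit_meas :: "real measure"
  where "unit_meas = restrict_space lborel {0<..<1}"

definition square_integrable :: "(real \<Rightarrow> real) \<Rightarrow> bool"
  where "square_integrable f \<longleftrightarrow>
    f \<in> borel_measurable unit_meas \<and> integrable unit_meas (\<lambda>x. (f x)\<^sup>2)"

definition L2_rel :: "(real \<Rightarrow> real) \<Rightarrow> (real \<Rightarrow> real) \<Rightarrow> bool"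
  where "L2_rel f g \<longleftrightarrow>
    square_integrable f \<and> square_integrable g \<and> (AE x in unit_meas. f x = g x)"

lemma L2_relD:
  assumes "L2_rel f g"
  shows "square_integrable f" "square_integrable g" "AE x in unit_meas. f x = g x"
  using assms by (auto simp: L2_rel_def)

lemma square_integrable_zero: "square_integrable (\<lambda>x. 0)"
  by (simp add: square_integrable_def)

lemma square_integrable_scale:
  assumes "square_integrable f"
  shows "square_integrable (\<lambda>x. c * f x)"
  using assms unfolding square_integrable_def by (auto simp: power_mult_distrib)

lemma square_integrable_mult:
  assumes f: "square_integrable f" and g: "square_integrable g"
  shows "integrable unit_meas (\<lambda>x. f x * g x)"
proof (rule Bochner_Integration.integrable_bound)
  show "integrable unit_meas (\<lambda>x. (f x)\<^sup>2 + (g x)\<^sup>2)"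
    using f g by (auto simp: square_integrable_def)
  show "(\<lambda>x. f x * g x) \<in> borel_measurable unit_meas"
    using f g by (auto simp: square_integrable_def)
  have "norm (a * b) \<le> norm (a\<^sup>2 + b\<^sup>2)" for a b :: real
  proof -
    have "2 * (\<bar>a\<bar> * \<bar>b\<bar>) \<le> a\<^sup>2 + b\<^sup>2"
      using zero_le_power2[of "\<bar>a\<bar> - \<bar>b\<bar>"] by (simp add: power2_diff)
    moreover have "0 \<le> \<bar>a\<bar> * \<bar>b\<bar>" by simp
    ultimately have "\<bar>a\<bar> * \<bar>b\<bar> \<le> a\<^sup>2 + b\<^sup>2" by linarith
    then show ?thesis by (simp add: abs_mult)
  qed
  then show "AE x in unit_meas. norm (f x * g x) \<le> norm ((f x)\<^sup>2 + (g x)\<^sup>2)"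
    by auto
qed

lemma square_integrable_add:
  assumes f: "square_integrable f" and g: "square_integrable g"
  shows "square_integrable (\<lambda>x. f x + g x)"
  using assms square_integrable_mult[OF f g] unfolding square_integrable_def
  by (auto simp: power2_sum mult.assoc)

quotient_type L2 = "real \<Rightarrow> real" / partial: L2_rel
proof (rule part_equivpI)
  show "\<exists>f. L2_rel f f"
    using square_integrable_zero by (auto simp: L2_rel_def)
  show "symp L2_rel"
    by (auto simp: L2_rel_def symp_def eq_commute)
  show "transp L2_rel"
    by (auto simp: L2_rel_def transp_def elim: eventually_elim2)
qed

instantiation L2 :: real_vector
begin

lift_definition zero_L2 :: L2 is "\<lambda>x. 0"
  by (simp add: L2_rel_def square_integrable_zero)

lift_definition plus_L2 :: "L2 \<Rightarrow> L2 \<Rightarrow> L2" is "\<lambda>f g x. f x + g x"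
  by (auto simp: L2_rel_def square_integrable_add elim: eventually_elim2)

lift_definition scaleR_L2 :: "real \<Rightarrow> L2 \<Rightarrow> L2" is "\<lambda>c f x. c * f x"
  by (auto simp: L2_rel_def square_integrable_scale elim: eventually_mono)

lift_definition uminus_L2 :: "L2 \<Rightarrow> L2" is "\<lambda>f x. - f x"
  using square_integrable_scale[of _ "-1"]
  by (auto simp: L2_rel_def elim: eventually_mono)

definition minus_L2 :: "L2 \<Rightarrow> L2 \<Rightarrow> L2" where "minus_L2 f g = f + (- g)"

instance
proof
  fix f g k :: L2 and c d :: real
  show "f + g + k = f + (g + k)"
    by transfer (auto simp: L2_rel_def square_integrable_add algebra_simps)
  show "f + g = g + f"
    by transfer (auto simp: L2_rel_def square_integrable_add algebra_simps)
  show "0 + f = f"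
    by transfer (auto simp: L2_rel_def)
  show "- f + f = 0"
    by transfer (auto simp: L2_rel_def square_integrable_zero)
  show "f - g = f + - g"
    by (rule minus_L2_def)
  show "c *\<^sub>R (f + g) = c *\<^sub>R f + c *\<^sub>R g"
    by transfer (auto simp: L2_rel_def square_integrable_add square_integrable_scale distrib_left)
  show "(c + d) *\<^sub>R f = c *\<^sub>R f + d *\<^sub>R f"
    by transfer (auto simp: L2_rel_def square_integrable_add square_integrable_scale distrib_right)
  show "c *\<^sub>R d *\<^sub>R f = (c * d) *\<^sub>R f"
    by transfer (auto simp: L2_rel_def square_integrable_scale mult.assoc)
  show "1 *\<^sub>R f = f"
    by transfer (auto simp: L2_rel_def)
qed

end

instantiation L2 :: real_inner
begin

lift_definition inner_L2 :: "L2 \<Rightarrow> L2 \<Rightarrow> real" is "\<lambda>f g. LINT x|unit_meas. f x * g x"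
proof -
  fix f f' g g' assume a: "L2_rel f f'" "L2_rel g g'"
  have m: "f \<in> borel_measurable unit_meas" "f' \<in> borel_measurable unit_meas"
    "g \<in> borel_measurable unit_meas" "g' \<in> borel_measurable unit_meas"
    using a by (auto simp: L2_rel_def square_integrable_def)
  have "AE x in unit_meas. f x * g x = f' x * g' x"
    using L2_relD(3)[OF a(1)] L2_relD(3)[OF a(2)] by eventually_elim simp
  then show "(LINT x|unit_meas. f x * g x) = (LINT x|unit_meas. f' x * g' x)"
    using m by (intro integral_cong_AE) auto
qed

definition norm_L2 :: "L2 \<Rightarrow> real" where "norm_L2 f = sqrt (inner f f)"

definition dist_L2 :: "L2 \<Rightarrow> L2 \<Rightarrow> real" where "dist_L2 f g = norm (f - g)"

definition sgn_L2 :: "L2 \<Rightarrow> L2" where "sgn_L2 f = f /\<^sub>R norm f"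

definition uniformity_L2 :: "(L2 \<times> L2) filter"
  where "uniformity_L2 = (INF e\<in>{0<..}. principal {(f, g). dist f g < e})"

definition open_L2 :: "L2 set \<Rightarrow> bool"
  where "open_L2 S = (\<forall>f\<in>S. \<forall>\<^sub>F (f', g) in uniformity. f' = f \<longrightarrow> g \<in> S)"

instance
proof
  fix f g k :: L2 and c :: real
  show "dist f g = norm (f - g)" by (rule dist_L2_def)
  show "sgn f = f /\<^sub>R norm f" by (rule sgn_L2_def)
  show "(uniformity :: (L2 \<times> L2) filter) = (INF e\<in>{0<..}. principal {(f, g). dist f g < e})"
    by (rule uniformity_L2_def)
  show "open U = (\<forall>f\<in>U. \<forall>\<^sub>F (f', g) in uniformity. f' = f \<longrightarrow> g \<in> U)" for U :: "L2 set"
    by (rule open_L2_def)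
  show "inner f g = inner g f"
    by transfer (simp add: mult.commute)
  show "inner (f + g) k = inner f k + inner g k"
    by transfer (simp add: L2_rel_def distrib_right square_integrable_mult)
  show "inner (c *\<^sub>R f) g = c * inner f g"
    by transfer (simp add: mult.assoc)
  show "0 \<le> inner f f"
    by transfer simp
  show "inner f f = 0 \<longleftrightarrow> f = 0"
  proof transfer
    fix f assume "L2_rel f f"
    then have f: "square_integrable f" by (rule L2_relD)
    then have i: "integrable unit_meas (\<lambda>x. f x * f x)"
      by (simp add: square_integrable_def power2_eq_square)
    have "(LINT x|unit_meas. f x * f x) = 0 \<longleftrightarrow> (AE x in unit_meas. f x * f x = 0)"
      by (rule integral_nonneg_eq_0_iff_AE[OF i]) auto
    also have "\<dots> \<longleftrightarrow> L2_rel f (\<lambda>x. 0)"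
      using f square_integrable_zero by (simp add: L2_rel_def)
    finally show "(LINT x|unit_meas. f x * f x) = 0 \<longleftrightarrow> L2_rel f (\<lambda>x. 0)" .
  qed
  show "norm f = sqrt (inner f f)" by (rule norm_L2_def)
qed

end


section \<open>Periodic shift\<close>

lemma frac_diff_cases:
  fixes x p :: real
  assumes "x \<in> {0<..<1}"
  shows "frac (x - p) = x - p - of_int \<lfloor>-p\<rfloor> \<or> frac (x - p) = x - p - of_int (\<lfloor>-p\<rfloor> + 1)"
proof -
  have "\<lfloor>x - p\<rfloor> = \<lfloor>-p\<rfloor> \<or> \<lfloor>x - p\<rfloor> = \<lfloor>-p\<rfloor> + 1"
    using assms unfolding greaterThanLessThan_iff by linarith
  then show ?thesis by (auto simp: frac_def)
qed

lemma AE_frac_pos: "AE x in lborel. 0 < frac (x - p :: real)"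
proof -
  have "countable (range (\<lambda>k::int. p + of_int k))" by simp
  then have "AE x in lborel. x \<notin> range (\<lambda>k::int. p + of_int k)"
    by (intro AE_not_in countable_imp_null_set_lborel)
  then show ?thesis
  proof eventually_elim
    case (elim x)
    have "frac (x - p) \<noteq> 0"
    proof
      assume "frac (x - p) = 0"
      then obtain k :: int where "x - p = of_int k" by (auto simp: frac_eq_0_iff elim: Ints_cases)
      then have "x = p + of_int k" by simp
      then show False using elim by blast
    qed
    then show ?case using frac_ge_0[of "x - p"] by linarith
  qed
qed

lemma AE_shift:
  fixes P :: "real \<Rightarrow> bool"
  assumes "AE y in unit_meas. P y"
  shows "AE x in unit_meas. P (frac (x - p))"
proof -
  have "AE y in lborel. y \<in> {0<..<1} \<longrightarrow> P y"
    using assms unfolding unit_meas_def by (subst (asm) AE_restrict_space_iff) auto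
  then obtain N where N: "N \<in> null_sets lborel" "{y. \<not> (y \<in> {0<..<1} \<longrightarrow> P y)} \<subseteq> N"
    by (auto elim!: AE_E simp: null_sets_def)
  have N_ae: "AE y in lborel. y \<notin> N" using N(1) by (rule AE_not_in)
  have pred: "Measurable.pred borel (\<lambda>y. y \<notin> N)"
    using N(1) by (auto simp: null_sets_def)
  have shift: "AE x in lborel. x - p - of_int j \<notin> N" for j :: int
    using AE_borel_affine[OF _ pred N_ae, of 1 "- p - of_int j"] by (simp add: algebra_simps)
  have "AE x in lborel. x \<in> {0<..<1} \<longrightarrow> P (frac (x - p))"
    using AE_frac_pos[of p] shift[of "\<lfloor>-p\<rfloor>"] shift[of "\<lfloor>-p\<rfloor> + 1"]
  proof eventually_elim
    case (elim x)
    show ?case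
    proof
      assume "x \<in> {0<..<1}"
      then have "frac (x - p) \<notin> N" using frac_diff_cases[of x p] elim by auto
      moreover have "frac (x - p) \<in> {0<..<1}" using elim(1) frac_lt_1[of "x - p"] by simp
      ultimately show "P (frac (x - p))" using N(2) by blast
    qed
  qed
  then show ?thesis unfolding unit_meas_def by (subst AE_restrict_space_iff) auto
qed

lemma square_integrable_shift:
  assumes "square_integrable f"
  shows "square_integrable (\<lambda>x. f (frac (x - p)))"
proof -
  have fm: "f \<in> borel_measurable (restrict_space lborel {0<..<1})"
    and fi: "integrable (restrict_space lborel {0<..<1}) (\<lambda>x. (f x)\<^sup>2)"
    using assms by (auto simp: square_integrable_def unit_meas_def)
  define f' where "f' y = (if y \<in> {0<..<1} then f y else f 0)" for y
  have "f \<in> borel_measurable (restrict_space borel {0<..<1})"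
    using fm by (simp cong: measurable_cong_sets add: sets_restrict_space)
  then have f'm: "f' \<in> borel_measurable borel"
    unfolding f'_def
    by (intro measurable_If_restrict_space_iff[THEN iffD2])
      (auto simp: greaterThanLessThan_def greaterThan_def lessThan_def Int_def)
  have frac_eq: "(frac :: real \<Rightarrow> real) = (\<lambda>y. y - of_int \<lfloor>y\<rfloor>)" by (auto simp: frac_def)
  have fracm: "(frac :: real \<Rightarrow> real) \<in> borel_measurable borel"
    unfolding frac_eq by measurable
  have eq: "f (frac (x - p)) = f' (frac (x - p))" for x
    using frac_lt_1[of "x - p"] frac_ge_0[of "x - p"] unfolding f'_def greaterThanLessThan_iff
    by (metis order_le_less)
  have Fm: "(\<lambda>x. f (frac (x - p))) \<in> borel_measurable borel"
    unfolding eq using f'm fracm by measurable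
  define G where "G y = indicator {0<..<1} y * (f y)\<^sup>2" for y :: real
  have G: "integrable lborel G"
    using fi by (simp add: integrable_restrict_space G_def[abs_def])
  have Gs: "integrable lborel (\<lambda>x. G (x - p - of_int j))" for j :: int
    using lborel_integrable_real_affine[OF G, of 1 "- p - of_int j"] by (simp add: algebra_simps)
  have "integrable lborel (\<lambda>x. indicator {0<..<1} x * (f (frac (x - p)))\<^sup>2)"
  proof (rule Bochner_Integration.integrable_bound)
    show "integrable lborel
      (\<lambda>x. G (x - p - of_int \<lfloor>-p\<rfloor>) + G (x - p - of_int (\<lfloor>-p\<rfloor> + 1)))"
      using Gs by (intro Bochner_Integration.integrable_add)
    show "(\<lambda>x. indicator {0<..<1} x * (f (frac (x - p)))\<^sup>2) \<in> borel_measurable lborel"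
      using Fm by simp
    have Gpos: "0 \<le> G y" for y by (simp add: G_def)
    show "AE x in lborel. norm (indicator {0<..<1} x * (f (frac (x - p)))\<^sup>2)
      \<le> norm (G (x - p - of_int \<lfloor>-p\<rfloor>) + G (x - p - of_int (\<lfloor>-p\<rfloor> + 1)))"
      using AE_frac_pos[of p]
    proof eventually_elim
      case (elim x)
      show ?case
      proof (cases "x \<in> {0<..<1}")
        case True
        have "(f (frac (x - p)))\<^sup>2 = G (frac (x - p))"
          using elim frac_lt_1[of "x - p"] by (simp add: G_def)
        also have "\<dots> \<le> G (x - p - of_int \<lfloor>-p\<rfloor>) + G (x - p - of_int (\<lfloor>-p\<rfloor> + 1))"
          using frac_diff_cases[OF True, of p] Gpos
          by (metis add_increasing add_increasing2 order_refl)
        finally show ?thesis using True Gpos by simp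
      qed simp
    qed
  qed
  then show ?thesis
    using Fm unfolding square_integrable_def unit_meas_def
    by (auto simp: integrable_restrict_space intro: measurable_restrict_space1)
qed

text \<open>For \<open>x \<in> (0,1)\<close>, \<open>f (frac (x - p))\<close> is the value at \<open>x - p\<close> of the 1-periodic extension
  of \<open>f\<close>, except where \<open>x - p\<close> is an integer, which happens for at most one such \<open>x\<close>.\<close>

lift_definition shift :: "real \<Rightarrow> L2 \<Rightarrow> L2" is "\<lambda>p f x. f (frac (x - p))"
proof -
  fix p :: real and f g assume "L2_rel f g"
  then show "L2_rel (\<lambda>x. f (frac (x - p))) (\<lambda>x. g (frac (x - p)))"
    using AE_shift[of "\<lambda>x. f x = g x" p] by (simp add: L2_rel_def square_integrable_shift)
qed


section \<open>Periodic hat functions\<close>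

text \<open>Meaningful for \<open>1 \<le> l \<le> n\<close> and \<open>n \<ge> 2\<close>. For \<open>n = 1\<close> the two nonzero branches
  of \<open>l = n\<close> overlap, and the first one wins.\<close>

definition hat_fun :: "nat \<Rightarrow> nat \<Rightarrow> real \<Rightarrow> real"
  where "hat_fun n l x = (let h = 1 / real n in
    if l < n then
      (if x \<in> {(real l - 1) * h<..real l * h} then (x - (real l - 1) * h) / h
       else if x \<in> {real l * h<..<(real l + 1) * h} then ((real l + 1) * h - x) / h
       else 0)
    else
      (if x \<in> {(real n - 1) * h<..real n * h} then (x - (real n - 1) * h) / h
       else if x \<in> {0<..<h} then (h - x) / h
       else 0))"

lemma square_integrable_hat_fun: "square_integrable (hat_fun n l)"
proof (cases "n = 0")
  case True
  then have "hat_fun n l = (\<lambda>x. 0)" by (auto simp: hat_fun_def)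
  then show ?thesis by (simp add: square_integrable_zero)
next
  case False
  have m: "hat_fun n l \<in> borel_measurable borel"
    unfolding hat_fun_def Let_def by measurable
  have b: "0 \<le> hat_fun n l x \<and> hat_fun n l x \<le> 1" for x
  proof -
    define h where "h = 1 / real n"
    have h: "0 < h" "real n * h = 1" using False by (auto simp: h_def)
    show ?thesis
      unfolding hat_fun_def Let_def h_def[symmetric]
      using h by (auto simp: divide_le_eq le_divide_eq left_diff_distrib distrib_right)
  qed
  have "finite_measure unit_meas"
    by (rule finite_measureI)
      (simp add: unit_meas_def space_restrict_space emeasure_restrict_space)
  then have "integrable unit_meas (\<lambda>x. (hat_fun n l x)\<^sup>2)"
  proof (rule finite_measure.integrable_const_bound[where B = 1])
    show "AE x in unit_meas. norm ((hat_fun n l x)\<^sup>2) \<le> 1"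
      using b by (auto simp: abs_square_le_1)
    show "(\<lambda>x. (hat_fun n l x)\<^sup>2) \<in> borel_measurable unit_meas"
      unfolding unit_meas_def using m by (intro measurable_restrict_space1) simp
  qed
  then show ?thesis
    using m by (auto simp: square_integrable_def unit_meas_def intro: measurable_restrict_space1)
qed

lift_definition hat :: "nat \<Rightarrow> nat \<Rightarrow> L2" is hat_fun
  by (simp add: L2_rel_def square_integrable_hat_fun)


section \<open>Index relations modulo \<open>n\<close>\<close>

text \<open>The four relations \<open>l = k - 2\<close>, \<open>l = k - 1\<close>, \<open>l = k\<close>, \<open>l = k + 1\<close> modulo \<open>n\<close> need not be
  mutually exclusive for \<open>n < 4\<close>; a case distinction over them prescribes a single value
  only if at most one of them holds.\<close>

definition cases_exclusive :: "nat \<Rightarrow> nat \<Rightarrow> nat \<Rightarrow> bool"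
  where "cases_exclusive n k l \<longleftrightarrow>
    (\<exists>\<^sub>\<le>\<^sub>1 d. d \<in> {-2, -1, 0, 1} \<and> [int l = int k + d] (mod int n))"

lemma cases_exclusive_ge_4:
  assumes "n \<ge> 4"
  shows "cases_exclusive n k l"
  unfolding cases_exclusive_def
proof (rule Uniq_I)
  fix d e :: int
  assume d: "d \<in> {-2, -1, 0, 1} \<and> [int l = int k + d] (mod int n)"
    and e: "e \<in> {-2, -1, 0, 1} \<and> [int l = int k + e] (mod int n)"
  then have "[int k + d = int k + e] (mod int n)" by (meson cong_sym cong_trans)
  then have "int n dvd d - e" by (simp add: cong_iff_dvd_diff)
  moreover have "\<bar>d - e\<bar> < int n" using d e assms by auto
  ultimately show "e = d" using dvd_imp_le_int[of "d - e" "int n"] by auto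
qed

end

theory Submission
  imports Defs
begin

text \<open>Up to null sets, \<open>\<psi>\<^sub>l\<close> shifted by \<open>q\<close> is the translate by \<open>q + l h\<close> of one 1-periodic
  Lipschitz hat \<open>g\<close> centred at 0. By periodicity the inner product becomes the integral over
  \<open>[-h, h]\<close> of \<open>g(y) g(y - q - d h)\<close>, where \<open>d\<close> is any representative of \<open>l - k\<close> modulo \<open>n\<close>.
  For \<open>d \<in> {-2, -1, 0, 1}\<close> the integrand is piecewise polynomial with breakpoints \<open>q - h\<close>, \<open>0\<close>, \<open>q\<close>;
  otherwise the supports do not overlap. Mutual exclusivity of the cases forces \<open>n \<ge> 3\<close>, and
  \<open>n \<ge> 4\<close> if \<open>d\<close> is \<open>-2\<close> or \<open>1\<close>, which rules out wrap-around contributions.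
  The curve of shifts is differentiable in \<open>L\<^sup>2\<close> by dominated convergence, since \<open>g\<close> is Lipschitz and
  differentiable off a countable set. Hence the second family of formulas needs no further
  integration: it is the right derivative in \<open>p\<close> of the first one.\<close>

section \<open>The 1-periodic hat function on the real line\<close>

definition tent :: "real \<Rightarrow> real"
  where "tent t = max 0 (1 - \<bar>t\<bar>)"

text \<open>Since \<open>tent\<close> is even, only the distance of \<open>x\<close> to its nearest
  integer matters, whence 1-periodicity. For \<open>n >= 2\<close> this is a hat of half-width
  \<open>1 / n\<close> around each integer.\<close>

definition ptent :: "nat \<Rightarrow> real \<Rightarrow> real"
  where "ptent n x = tent (real n * (x - of_int (round x)))"

lemma ptent_add_int: "ptent n (x + of_int j) = ptent n x"
proof -
  have "round (x + of_int j) = round x + j"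
    by (simp add: round_def add.assoc add.commute[of "of_int j"])
       (metis add.assoc floor_add_int)
  then show ?thesis by (simp add: ptent_def)
qed

text \<open>The distance to the nearest integer is a minimum of 1-Lipschitz functions, hence
  1-Lipschitz although \<open>round\<close> jumps; \<open>tent\<close> is 1-Lipschitz in the
  absolute value of its argument.\<close>

lemma ptent_lipschitz: "\<bar>ptent n x - ptent n y\<bar> \<le> real n * \<bar>x - y\<bar>"
proof -
  have 1: "\<bar>x - of_int (round x)\<bar> \<le> \<bar>y - of_int (round y)\<bar> + \<bar>x - y\<bar>" for x y :: real
    using round_diff_minimal[of x "round y"] by linarith
  have "\<bar>\<bar>x - of_int (round x)\<bar> - \<bar>y - of_int (round y)\<bar>\<bar> \<le> \<bar>x - y\<bar>"
    using 1[of x y] 1[of y x] by linarith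
  then have "real n * \<bar>\<bar>x - of_int (round x)\<bar> - \<bar>y - of_int (round y)\<bar>\<bar> \<le> real n * \<bar>x - y\<bar>"
    by (rule mult_left_mono) simp
  then have "\<bar>real n * \<bar>x - of_int (round x)\<bar> - real n * \<bar>y - of_int (round y)\<bar>\<bar> \<le> real n * \<bar>x - y\<bar>"
    by (simp add: abs_mult flip: right_diff_distrib)
  then show ?thesis
    unfolding ptent_def tent_def abs_mult abs_of_nat by linarith
qed

lemma continuous_on_ptent: "continuous_on A (ptent n)"
proof -
  have "(real n)-lipschitz_on A (ptent n)"
    by (rule lipschitz_onI) (simp_all add: dist_real_def ptent_lipschitz)
  then show ?thesis by (rule lipschitz_on_continuous_on)
qed

text \<open>Where \<open>round x\<close> is not 0, \<open>x\<close> is at least \<open>1 / n\<close>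
  away from its nearest integer and so from 0 too, which makes both sides 0. For
  \<open>n >= 3\<close> the window is wider than \<open>[-1/2, 1/2]\<close>, and later estimates
  rely on this.\<close>

lemma ptent_eq_tent:
  assumes "n > 0" and "\<bar>x\<bar> \<le> 1 - 1 / real n"
  shows "ptent n x = tent (real n * x)"
proof (cases "round x = 0")
  case False
  then have "1 \<le> \<bar>real_of_int (round x)\<bar>"
    by linarith
  then have 1: "1 / real n \<le> \<bar>x - of_int (round x)\<bar>" using assms(2) by linarith
  moreover have "\<bar>x - of_int (round x)\<bar> \<le> \<bar>x\<bar>"
    using round_diff_minimal[of x 0] by simp
  ultimately have "1 / real n \<le> \<bar>x\<bar>" by linarith
  with 1 have "1 \<le> real n * \<bar>x - of_int (round x)\<bar>" "1 \<le> real n * \<bar>x\<bar>"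
    using assms(1) by (simp_all add: field_simps)
  then show ?thesis
    by (simp add: ptent_def tent_def abs_mult)
qed (simp add: ptent_def)

lemma ptent_eq_0:
  assumes "n > 0" and "1 / real n \<le> \<bar>x\<bar>" and "\<bar>x\<bar> \<le> 1 - 1 / real n"
  shows "ptent n x = 0"
  using assms by (simp add: ptent_eq_tent tent_def abs_mult field_simps)

text \<open>For \<open>l < n\<close> the argument stays in the window of
  \<open>ptent_eq_tent\<close>. For \<open>l = n\<close> the two branches of \<open>hat_fun\<close>
  are halves of the hats around 1 and 0, which \<open>n >= 2\<close> keeps apart.\<close>

lemma hat_fun_eq_ptent:
  assumes n: "2 \<le> n" and l: "l \<in> {1..n}" and x: "x \<in> {0<..<1}"
  shows "hat_fun n l x = ptent n (x - real l / real n)"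
proof (cases "l < n")
  case True
  define h where "h = 1 / real n"
  have h: "0 < h" "real n * h = 1" using n by (auto simp: h_def)
  have "1 * h \<le> real l * h" "real l * h \<le> (real n - 1) * h"
    using h l True by (intro mult_right_mono; simp)+
  then have "\<bar>x - real l / real n\<bar> \<le> 1 - 1 / real n"
    using x h n by (simp add: h_def diff_divide_distrib abs_le_iff)
  then have "ptent n (x - real l / real n) = tent (real n * (x - real l / real n))"
    using n by (intro ptent_eq_tent) auto
  also have "real n * (x - real l / real n) = (x - real l * h) / h"
    using n by (simp add: h_def field_simps)
  also have "tent \<dots> = hat_fun n l x"
    using True h unfolding tent_def hat_fun_def Let_def h_def[symmetric]
    by (auto simp: field_simps max_def abs_if)
  finally show ?thesis by simp
next
  case False
  then have l: "l = n" using l by simp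
  define h where "h = 1 / real n"
  have h: "0 < h" "real n * h = 1" using n by (auto simp: h_def)
  have h2: "h \<le> 1 / 2" using n by (simp add: h_def field_simps)
  have eq: "ptent n (x - real l / real n) = ptent n x"
    using ptent_add_int[of n x "-1"] n l by simp
  show ?thesis
  \<comment> \<open>The hat around 0 is used up to \<open>1 - h\<close> and the one around 1 beyond,
    where \<open>x - 1\<close> lies in the window because \<open>h <= 1/2\<close>.\<close>
  proof (cases "x \<le> 1 - h")
    case True
    then have "ptent n x = tent (real n * x)"
      using x n by (intro ptent_eq_tent) (auto simp: h_def)
    also have "real n * x = x / h" by (simp add: h_def)
    also have "tent \<dots> = hat_fun n l x"
      using True h h2 x l unfolding tent_def hat_fun_def Let_def h_def[symmetric]
      by (auto simp: field_simps max_def abs_if)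
    finally show ?thesis using eq by simp
  next
    case False
    then have "ptent n (x - 1) = tent (real n * (x - 1))"
      using x n h2 False by (intro ptent_eq_tent) (auto simp flip: h_def)
    also have "real n * (x - 1) = (x - 1) / h" by (simp add: h_def)
    also have "tent \<dots> = hat_fun n l x"
      using False h h2 x l unfolding tent_def hat_fun_def Let_def h_def[symmetric]
      by (auto simp: field_simps max_def abs_if)
    finally show ?thesis using n l by simp
  qed
qed

section \<open>Bounded representatives of \<open>L2\<close> classes\<close>

lemma square_integrable_bounded:
  assumes m: "f \<in> borel_measurable borel" and b: "\<And>x. \<bar>f x\<bar> \<le> B"
  shows "square_integrable f"
proof -
  have m': "f \<in> borel_measurable unit_meas"
    unfolding unit_meas_def using m by (intro measurable_restrict_space1) simp
  have "finite_measure unit_meas"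
    by (rule finite_measureI)
      (simp add: unit_meas_def space_restrict_space emeasure_restrict_space)
  then have "integrable unit_meas (\<lambda>x. (f x)\<^sup>2)"
  proof (rule finite_measure.integrable_const_bound[where B = "B\<^sup>2"])
    show "AE x in unit_meas. norm ((f x)\<^sup>2) \<le> B\<^sup>2"
      using power_mono[OF b abs_ge_zero, of _ 2] by (auto simp: power2_abs)
    show "(\<lambda>x. (f x)\<^sup>2) \<in> borel_measurable unit_meas"
      using m' by simp
  qed
  with m' show ?thesis by (simp add: square_integrable_def)
qed

lemma abs_L2_eq:
  assumes "square_integrable f" "square_integrable g" "AE x in unit_meas. f x = g x"
  shows "abs_L2 f = abs_L2 g"
  using assms by (intro Quotient_rel_abs[OF Quotient_L2]) (simp add: L2_rel_def)

lemma L2_rel_refl: "square_integrable f \<Longrightarrow> L2_rel f f"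
  by (simp add: L2_rel_def)

lemma inner_abs_L2:
  assumes "square_integrable f" "square_integrable g"
  shows "inner (abs_L2 f) (abs_L2 g) = (LINT x|unit_meas. f x * g x)"
  using assms by (simp add: inner_L2.abs_eq L2_rel_refl)

lemma diff_abs_L2:
  assumes "square_integrable f" "square_integrable g"
  shows "abs_L2 f - abs_L2 g = abs_L2 (\<lambda>x. f x - g x)"
  using assms square_integrable_scale[of g "-1"]
  by (simp add: minus_L2_def plus_L2.abs_eq uminus_L2.abs_eq L2_rel_refl)

lemma scaleR_abs_L2:
  assumes "square_integrable f"
  shows "c *\<^sub>R abs_L2 f = abs_L2 (\<lambda>x. c * f x)"
  using assms by (simp add: scaleR_L2.abs_eq L2_rel_refl)

lemma shift_abs_L2:
  assumes "square_integrable f"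
  shows "shift p (abs_L2 f) = abs_L2 (\<lambda>x. f (frac (x - p)))"
  using assms by (simp add: shift.abs_eq L2_rel_refl)

lemma hat_abs_L2: "hat n l = abs_L2 (hat_fun n l)"
  by (simp add: hat_def)

lemma borel_measurable_ptent [measurable]: "ptent n \<in> borel_measurable borel"
  by (intro borel_measurable_continuous_onI continuous_on_ptent)

lemma abs_ptent_le: "\<bar>ptent n x\<bar> \<le> 1"
  by (simp add: ptent_def tent_def)

lemma square_integrable_ptent: "square_integrable (\<lambda>x. ptent n (x - c))"
  by (rule square_integrable_bounded[where B = 1]) (simp_all add: abs_ptent_le)

lemma AE_unit_measI:
  assumes "AE x in lborel. P x"
  shows "AE x in unit_meas. P x"
  unfolding unit_meas_def using assms
  by (subst AE_restrict_space_iff) auto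

lemma hat_eq_ptent:
  assumes "2 \<le> n" "l \<in> {1..n}"
  shows "hat n l = abs_L2 (\<lambda>x. ptent n (x - real l / real n))"
  unfolding hat_abs_L2
proof (rule abs_L2_eq[OF square_integrable_hat_fun square_integrable_ptent])
  show "AE x in unit_meas. hat_fun n l x = ptent n (x - real l / real n)"
    unfolding unit_meas_def
    by (subst AE_restrict_space_iff) (use hat_fun_eq_ptent[OF assms] in auto)
qed

text \<open>\<open>frac\<close> alters its argument by an integer, which the periodic hat absorbs;
  the shift becomes a plain translation of the representative.\<close>

lemma shift_hat:
  assumes "2 \<le> n" "l \<in> {1..n}"
  shows "shift q (hat n l) = abs_L2 (\<lambda>x. ptent n (x - q - real l / real n))"
proof -
  have "ptent n (frac (x - q) - real l / real n) = ptent n (x - q - real l / real n)" for x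
    using ptent_add_int[of n "x - q - real l / real n" "- \<lfloor>x - q\<rfloor>"]
    by (simp add: frac_def algebra_simps)
  then show ?thesis
    by (simp add: hat_eq_ptent[OF assms] shift_abs_L2 square_integrable_ptent)
qed

section \<open>Differentiability of the curve of shifts in \<open>L2\<close>\<close>

text \<open>The normalized remainder has norm equal to the \<open>L2\<close> norm of
  \<open>r q\<close>, the error of the pointwise difference quotient. It tends to 0 almost
  everywhere, and the Lipschitz bound in \<open>q\<close> dominates it by
  \<open>2 * C\<close>.\<close>

lemma has_vector_derivative_abs_L2:
  fixes f :: "real \<Rightarrow> real \<Rightarrow> real"
  assumes f: "\<And>q. f q \<in> borel_measurable borel" "\<And>q x. \<bar>f q x\<bar> \<le> B"
    and d: "d \<in> borel_measurable borel" "\<And>x. \<bar>d x\<bar> \<le> C"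
    and lip: "\<And>q x. \<bar>f q x - f p x\<bar> \<le> C * \<bar>q - p\<bar>"
    and deriv: "AE x in unit_meas. ((\<lambda>q. f q x) has_real_derivative d x) (at p)"
  shows "((\<lambda>q. abs_L2 (f q)) has_vector_derivative abs_L2 d) (at p)"
proof -
  have sf: "square_integrable (f q)" for q
    using f by (rule square_integrable_bounded)
  have sd: "square_integrable d"
    using d by (rule square_integrable_bounded)
  define r where "r q x = (f q x - f p x) / (q - p) - d x" for q x
  have rm: "r q \<in> borel_measurable borel" for q
    unfolding r_def using f d by measurable
  have rb: "\<bar>r q x\<bar> \<le> 2 * C" if "q \<noteq> p" for q x
  proof -
    have "\<bar>(f q x - f p x) / (q - p)\<bar> \<le> C"
      using lip[of q x] that by (simp add: divide_le_eq abs_divide)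
    then show ?thesis using d(2)[of x] unfolding r_def by linarith
  qed
  have norm_r: "norm (abs_L2 (f q) - abs_L2 (f p) - (q - p) *\<^sub>R abs_L2 d) / norm (q - p)
      = sqrt (LINT x|unit_meas. (r q x)\<^sup>2)" if "q \<noteq> p" for q
  proof -
    have sr: "square_integrable (r q)"
      using rm rb[OF that] by (rule square_integrable_bounded)
    have "abs_L2 (f q) - abs_L2 (f p) - (q - p) *\<^sub>R abs_L2 d = (q - p) *\<^sub>R abs_L2 (r q)"
    proof -
      have s: "square_integrable (\<lambda>x. f q x - f p x)"
        using square_integrable_add[OF sf square_integrable_scale[OF sf, of "-1"]] by simp
      have "abs_L2 (f q) - abs_L2 (f p) - (q - p) *\<^sub>R abs_L2 d
        = abs_L2 (\<lambda>x. f q x - f p x - (q - p) * d x)"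
        using s by (simp add: diff_abs_L2 scaleR_abs_L2 sf sd square_integrable_scale)
      also have "(\<lambda>x. f q x - f p x - (q - p) * d x) = (\<lambda>x. (q - p) * r q x)"
        using that by (auto simp: r_def field_simps)
      finally show ?thesis by (simp add: scaleR_abs_L2 sr)
    qed
    then have "norm (abs_L2 (f q) - abs_L2 (f p) - (q - p) *\<^sub>R abs_L2 d) / norm (q - p)
        = norm (abs_L2 (r q))"
      using that by simp
    also have "\<dots> = sqrt (LINT x|unit_meas. (r q x)\<^sup>2)"
      by (simp add: norm_eq_sqrt_inner inner_abs_L2 sr power2_eq_square)
    finally show ?thesis .
  qed
  have "((\<lambda>q. LINT x|unit_meas. (r q x)\<^sup>2) \<longlongrightarrow> 0) (at p)"
    \<comment> \<open>Dominated convergence concerns sequences, so the limit at \<open>p\<close> is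
      tested along sequences that avoid \<open>p\<close>.\<close>
    unfolding tendsto_at_iff_sequentially comp_def
  proof (intro allI impI)
    fix X :: "nat \<Rightarrow> real" assume X: "\<forall>i. X i \<in> UNIV - {p}" "X \<longlonglongrightarrow> p"
    have "(\<lambda>i. LINT x|unit_meas. (r (X i) x)\<^sup>2) \<longlonglongrightarrow> (LINT x|unit_meas. 0)"
    proof (rule integral_dominated_convergence[where w = "\<lambda>x. (2 * C)\<^sup>2"])
      show "(\<lambda>x. 0) \<in> borel_measurable unit_meas" by simp
      show "(\<lambda>x. (r (X i) x)\<^sup>2) \<in> borel_measurable unit_meas" for i
        unfolding unit_meas_def using rm by (intro measurable_restrict_space1) simp
      show "integrable unit_meas (\<lambda>x. (2 * C)\<^sup>2)"
        using square_integrable_bounded[of "\<lambda>x. 2 * C" "\<bar>2 * C\<bar>"]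
        by (simp add: square_integrable_def)
      show "AE x in unit_meas. (\<lambda>i. (r (X i) x)\<^sup>2) \<longlonglongrightarrow> 0"
        using deriv
      proof eventually_elim
        case (elim x)
        then have "((\<lambda>q. (f q x - f p x) / (q - p)) \<longlongrightarrow> d x) (at p)"
          by (simp add: has_field_derivative_iff)
        then have "(\<lambda>i. (f (X i) x - f p x) / (X i - p)) \<longlonglongrightarrow> d x"
          using X unfolding tendsto_at_iff_sequentially comp_def by blast
        then have "(\<lambda>i. (r (X i) x)\<^sup>2) \<longlonglongrightarrow> (d x - d x)\<^sup>2"
          unfolding r_def by (intro tendsto_intros)
        then show ?case by simp
      qed
      show "AE x in unit_meas. norm ((r (X i) x)\<^sup>2) \<le> (2 * C)\<^sup>2" for i
        using power_mono[OF rb, of "X i" _ 2] X(1) by (auto simp: power2_abs)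
    qed
    then show "(\<lambda>i. LINT x|unit_meas. (r (X i) x)\<^sup>2) \<longlonglongrightarrow> 0" by simp
  qed
  then have "((\<lambda>q. sqrt (LINT x|unit_meas. (r q x)\<^sup>2)) \<longlongrightarrow> 0) (at p)"
    using tendsto_real_sqrt by fastforce
  then have "((\<lambda>q. norm (abs_L2 (f q) - abs_L2 (f p) - (q - p) *\<^sub>R abs_L2 d) / norm (q - p))
      \<longlongrightarrow> 0) (at p)"
    by (rule Lim_transform_eventually)
      (auto simp: eventually_at_filter norm_r[unfolded real_norm_def] intro!: always_eventually)
  then show ?thesis
    unfolding has_vector_derivative_def has_derivative_iff_norm
    by (auto intro: bounded_linear_scaleR_left)
qed

text \<open>The almost everywhere derivative of \<open>ptent n\<close>. The value 0 at the kinks is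
  a mere default, as only the class in \<open>L2\<close> counts.\<close>

definition dptent :: "nat \<Rightarrow> real \<Rightarrow> real"
  where "dptent n x = (let t = real n * (x - of_int (round x)) in
    if 0 < t \<and> t < 1 then - real n else if -1 < t \<and> t < 0 then real n else 0)"

lemma borel_measurable_dptent [measurable]: "dptent n \<in> borel_measurable borel"
  unfolding dptent_def Let_def round_def by measurable

lemma abs_dptent_le: "\<bar>dptent n x\<bar> \<le> real n"
  by (simp add: dptent_def Let_def)

lemma ptent_has_real_derivative:
  assumes n: "3 \<le> n" and x: "x \<notin> range (\<lambda>j::int. of_int j / real n)"
  shows "(ptent n has_real_derivative dptent n x) (at x)"
proof -
  define h where "h = 1 / real n"
  have h: "0 < h" "real n * h = 1" "h \<le> 1 / 3"
    using n by (auto simp: h_def field_simps)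
  define m where "m = round x"
  have xm: "\<bar>x - of_int m\<bar> \<le> 1 / 2"
    unfolding m_def using of_int_round_abs_le[of x] by (simp add: abs_minus_commute)
  \<comment> \<open>The kinks closest to \<open>x\<close> are \<open>m - h\<close>, \<open>m\<close>
    and \<open>m + h\<close>, all multiples of \<open>1 / n\<close> and hence excluded.\<close>
  have ne: "x \<noteq> of_int m + of_int j * h" for j
  proof
    assume "x = of_int m + of_int j * h"
    then have "x = of_int (m * int n + j) / real n"
      using n by (simp add: h_def field_simps)
    then show False using x by blast
  qed
  have ne': "x \<noteq> of_int m" "x \<noteq> of_int m + h" "x \<noteq> of_int m - h"
    using ne[of 0] ne[of 1] ne[of "-1"] by auto
  have eq: "ptent n y = tent (real n * (y - of_int m))" if "\<bar>y - of_int m\<bar> \<le> 1 - h" for y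
    using ptent_eq_tent[of n "y - of_int m"] ptent_add_int[of n y "- m"] n that
    by (simp add: h_def)
  have less: "real n * a < real n * b \<longleftrightarrow> a < b" for a b :: real
    using n by simp
  consider "of_int m < x" "x < of_int m + h" | "of_int m - h < x" "x < of_int m"
    | "of_int m + h < x" | "x < of_int m - h"
    using ne' by linarith
  then show ?thesis
  proof cases
    case 1
    have "((\<lambda>y. 1 - real n * (y - of_int m)) has_real_derivative - real n) (at x)"
      by (auto intro!: derivative_eq_intros)
    then have "(ptent n has_real_derivative - real n) (at x)"
    proof (rule has_field_derivative_transform_within_open)
      show "x \<in> {of_int m <..< of_int m + h}" using 1 by simp
      show "1 - real n * (y - of_int m) = ptent n y" if "y \<in> {of_int m <..< of_int m + h}" for y
        using that h less[of 0 "y - of_int m"] less[of "y - of_int m" h]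
        by (subst eq) (auto simp: tent_def)
    qed simp
    moreover have "dptent n x = - real n"
      using 1 h less[of 0 "x - of_int m"] less[of "x - of_int m" h]
      by (simp add: dptent_def Let_def flip: m_def)
    ultimately show ?thesis by simp
  next
    case 2
    have "((\<lambda>y. 1 + real n * (y - of_int m)) has_real_derivative real n) (at x)"
      by (auto intro!: derivative_eq_intros)
    then have "(ptent n has_real_derivative real n) (at x)"
    proof (rule has_field_derivative_transform_within_open)
      show "x \<in> {of_int m - h <..< of_int m}" using 2 by simp
      show "1 + real n * (y - of_int m) = ptent n y" if "y \<in> {of_int m - h <..< of_int m}" for y
        using that h less[of "y - of_int m" 0] less[of "-h" "y - of_int m"]
        by (subst eq) (auto simp: tent_def)
    qed simp
    moreover have "dptent n x = real n"
      using 2 h less[of "x - of_int m" 0] less[of "-h" "x - of_int m"]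
      by (simp add: dptent_def Let_def flip: m_def)
    ultimately show ?thesis by simp
  next
    case 3
    have "((\<lambda>y. 0) has_real_derivative 0) (at x)"
      by simp
    then have "(ptent n has_real_derivative 0) (at x)"
    proof (rule has_field_derivative_transform_within_open)
      \<comment> \<open>The nearest integer is at most 1/2 away and \<open>h <= 1/3\<close>, so
        \<open>x\<close> stays strictly left of the next hat.\<close>
      show "x \<in> {of_int m + h <..< of_int m + 1 - h}" using 3 xm h by (simp add: abs_le_iff)
      show "0 = ptent n y" if "y \<in> {of_int m + h <..< of_int m + 1 - h}" for y
        using that h less[of h "y - of_int m"]
        by (subst eq) (auto simp: tent_def)
    qed simp
    moreover have "dptent n x = 0"
      using 3 h less[of h "x - of_int m"]
      by (simp add: dptent_def Let_def flip: m_def)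
    ultimately show ?thesis by simp
  next
    case 4
    have "((\<lambda>y. 0) has_real_derivative 0) (at x)"
      by simp
    then have "(ptent n has_real_derivative 0) (at x)"
    proof (rule has_field_derivative_transform_within_open)
      show "x \<in> {of_int m - 1 + h <..< of_int m - h}" using 4 xm h by (simp add: abs_le_iff)
      show "0 = ptent n y" if "y \<in> {of_int m - 1 + h <..< of_int m - h}" for y
        using that h less[of "y - of_int m" "-h"]
        by (subst eq) (auto simp: tent_def)
    qed simp
    moreover have "dptent n x = 0"
      using 4 h less[of "x - of_int m" "-h"]
      by (simp add: dptent_def Let_def flip: m_def)
    ultimately show ?thesis by simp
  qed
qed

text \<open>For fixed \<open>p\<close> the kinks of the translate occupy only countably many
  \<open>x\<close>. So the curve is differentiable at every real \<open>p\<close>, including the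
  grid points where the closed formulas change.\<close>

lemma shift_hat_differentiable:
  assumes n: "3 \<le> n" and l: "l \<in> {1..n}"
  shows "(\<lambda>q. shift q (hat n l)) differentiable (at p)"
proof -
  define c where "c = real l / real n"
  have "((\<lambda>q. abs_L2 (\<lambda>x. ptent n (x - q - c)))
    has_vector_derivative abs_L2 (\<lambda>x. - dptent n (x - p - c))) (at p)"
  proof (rule has_vector_derivative_abs_L2[where B = 1 and C = "real n"])
    show "(\<lambda>x. ptent n (x - q - c)) \<in> borel_measurable borel" for q
      by measurable
    show "(\<lambda>x. - dptent n (x - p - c)) \<in> borel_measurable borel"
      by measurable
    show "\<bar>ptent n (x - q - c) - ptent n (x - p - c)\<bar> \<le> real n * \<bar>q - p\<bar>" for q x
      using ptent_lipschitz[of n "x - q - c" "x - p - c"] by (simp add: abs_minus_commute)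
    have "AE x in lborel. x \<notin> range (\<lambda>j::int. p + c + of_int j / real n)"
      by (intro AE_not_in countable_imp_null_set_lborel) simp
    then have "AE x in lborel.
        ((\<lambda>q. ptent n (x - q - c)) has_real_derivative - dptent n (x - p - c)) (at p)"
    proof eventually_elim
      case (elim x)
      have "x - p - c \<notin> range (\<lambda>j::int. of_int j / real n)"
      proof
        assume "x - p - c \<in> range (\<lambda>j::int. of_int j / real n)"
        then obtain j :: int where "x - p - c = of_int j / real n" by blast
        then have "x = p + c + of_int j / real n" by simp
        then show False using elim by blast
      qed
      then have d: "(ptent n has_real_derivative dptent n (x - p - c)) (at (x - p - c))"
        by (rule ptent_has_real_derivative[OF n])
      have "((\<lambda>q. x - q - c) has_real_derivative - 1) (at p)"
        by (auto intro!: derivative_eq_intros)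
      from DERIV_chain2[of "ptent n", OF d this] show ?case by simp
    qed
    then show "AE x in unit_meas.
        ((\<lambda>q. ptent n (x - q - c)) has_real_derivative - dptent n (x - p - c)) (at p)"
      by (rule AE_unit_measI)
  qed (simp_all add: abs_ptent_le abs_dptent_le)
  then show ?thesis
    using n l by (auto simp: shift_hat c_def intro: differentiableI_vector)
qed

section \<open>Reduction of the inner product to the support of one hat\<close>

text \<open>Both intervals contain \<open>[a, b + 1]\<close>, and the remaining pieces
  \<open>[b, a]\<close> and \<open>[b + 1, a + 1]\<close> differ by one period.\<close>

lemma integral_periodic_shift:
  fixes f :: "real \<Rightarrow> real"
  assumes f: "continuous_on UNIV f" and per: "\<And>x. f (x + 1) = f x"
    and ab: "b \<le> a" "a \<le> b + 1"
  shows "integral {a..a + 1} f = integral {b..b + 1} f"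
proof -
  have int: "f integrable_on {u..v}" for u v
    using f by (intro integrable_continuous_real) (rule continuous_on_subset, auto)
  have "integral {b + 1..a + 1} f = integral {b..a} f"
    using integral_shift_real_ivl[of "b + 1" 1 "a + 1" f] by (simp add: per)
  moreover have "integral {b..a} f + integral {a..b + 1} f = integral {b..b + 1} f"
    using ab int by (intro Henstock_Kurzweil_Integration.integral_combine) auto
  moreover have "integral {a..b + 1} f + integral {b + 1..a + 1} f = integral {a..a + 1} f"
    using ab int by (intro Henstock_Kurzweil_Integration.integral_combine) auto
  ultimately show ?thesis by simp
qed

text \<open>Passes from the Lebesgue integral defining the inner product to the gauge integral,
  where intervals are translated and split.\<close>

lemma integral_unit_meas:
  fixes f :: "real \<Rightarrow> real"
  assumes "continuous_on UNIV f"
  shows "(LINT x|unit_meas. f x) = integral {0..1} f"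
proof -
  have "set_integrable lborel {0..1} f"
    using assms by (intro borel_integrable_atLeastAtMost') (rule continuous_on_subset, auto)
  then have "set_integrable lborel {0<..<1} f"
    by (rule set_integrable_subset) auto
  then have "(LINT x:{0<..<1}|lborel. f x) = integral {0<..<1} f"
    by (rule set_borel_integral_eq_integral)
  then show ?thesis
    by (simp add: unit_meas_def integral_restrict_space set_lebesgue_integral_def
        integral_open_interval_real)
qed

lemma inner_hat_shift_hat:
  assumes n: "3 \<le> n" and k: "k \<in> {1..n}" and l: "l \<in> {1..n}"
    and d: "[int l = int k + d] (mod int n)"
  shows "inner (hat n k) (shift q (hat n l)) =
    integral {- 1 / real n..1 / real n}
      (\<lambda>y. tent (real n * y) * ptent n (y - q - of_int d / real n))"
proof -
  define h where "h = 1 / real n"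
  have h: "0 < h" "h \<le> 1 / 3" using n by (auto simp: h_def field_simps)
  define F where "F y = ptent n y * ptent n (y - q - of_int d / real n)" for y
  have F_cont: "continuous_on A F" for A
    unfolding F_def
    by (intro continuous_intros continuous_on_compose2[OF continuous_on_ptent[of UNIV]]
      subset_UNIV)
  have F_int: "F integrable_on {u..v}" for u v
    using F_cont by (intro integrable_continuous_real)
  have tent: "ptent n y = tent (real n * y)" if "y \<in> {- h..h}" for y
    using that h n by (intro ptent_eq_tent) (auto simp flip: h_def)
  obtain j where j: "int l = int k + d + int n * j"
    using d by (metis cong_iff_lin cong_sym)
  \<comment> \<open>The multiple \<open>n * j\<close> of the index becomes the integer translation
    \<open>j\<close>, so any representative \<open>d\<close> of \<open>l - k\<close> will
    do.\<close>
  have *: "ptent n (x - q - real l / real n) = ptent n (x - real k / real n - q - of_int d / real n)"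
    for x
  proof -
    have "real l = real k + of_int d + real n * of_int j"
      using arg_cong[OF j, of real_of_int] by simp
    then have "real l / real n = real k / real n + of_int d / real n + of_int j"
      using n by (simp add: field_simps)
    then show ?thesis
      using ptent_add_int[of n "x - q - real l / real n" j] by (simp add: algebra_simps)
  qed
  have "inner (hat n k) (shift q (hat n l)) =
    (LINT x|unit_meas. ptent n (x - real k / real n) * ptent n (x - q - real l / real n))"
    using n k l square_integrable_ptent[of n "q + real l / real n"]
    by (simp add: hat_eq_ptent[of n k] shift_hat inner_abs_L2 square_integrable_ptent diff_diff_eq)
  also have "\<dots> = (LINT x|unit_meas. F (x - real k / real n))"
    by (simp add: F_def *)
  also have "\<dots> = integral {0..1} (\<lambda>x. F (x - real k / real n))"
    by (rule integral_unit_meas, rule continuous_on_compose2[OF F_cont[of UNIV]])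
      (auto intro!: continuous_intros)
  also have "\<dots> = integral {- real k / real n..- real k / real n + 1} F"
    using integral_shift_real_ivl[of "- real k / real n" "- real k / real n" "- real k / real n + 1" F]
    by simp
  also have "\<dots> = integral {- h..- h + 1} F"
  proof (rule integral_periodic_shift[symmetric])
    show "continuous_on UNIV F" by (rule F_cont)
    show "F (y + 1) = F y" for y
      using ptent_add_int[of n y 1] ptent_add_int[of n "y - q - of_int d / real n" 1]
      by (simp add: F_def algebra_simps)
    \<comment> \<open>As \<open>1 <= k <= n\<close>, the two period intervals start at most one
      period apart.\<close>
    show "- real k / real n \<le> - h" "- h \<le> - real k / real n + 1"
      using k n h by (auto simp: h_def divide_simps)
  qed
  also have "\<dots> = integral {- h..h} F + integral {h..- h + 1} F"
    using h F_int by (intro Henstock_Kurzweil_Integration.integral_combine[symmetric]) auto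
  \<comment> \<open>\<open>[h, 1 - h]\<close> is the gap between the hats around 0 and 1, where the
    first factor vanishes.\<close>
  also have "integral {h..- h + 1} F = integral {h..- h + 1} (\<lambda>y. 0)"
    using n h by (intro integral_cong) (auto simp: F_def h_def ptent_eq_0)
  also have "integral {- h..h} F = integral {- h..h}
      (\<lambda>y. tent (real n * y) * ptent n (y - q - of_int d / real n))"
    using tent by (intro integral_cong) (auto simp: F_def)
  finally show ?thesis by (simp add: h_def)
qed

section \<open>Explicit integrals of products of piecewise affine functions\<close>

lemma has_integral_affine_product:
  fixes a b c e u v :: real
  assumes "u \<le> v"
  shows "((\<lambda>y. (a + b * y) * (c + e * y)) has_integral
    a * c * (v - u) + (a * e + b * c) * (v\<^sup>2 - u\<^sup>2) / 2 + b * e * (v^3 - u^3) / 3) {u..v}"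
proof -
  define G where "G y = a * c * y + (a * e + b * c) * y\<^sup>2 / 2 + b * e * y^3 / 3" for y
  have "((\<lambda>y. (a + b * y) * (c + e * y)) has_integral G v - G u) {u..v}"
    using assms
  proof (rule fundamental_theorem_of_calculus)
    show "(G has_vector_derivative (a + b * y) * (c + e * y)) (at y within {u..v})" for y
      unfolding G_def has_real_derivative_iff_has_vector_derivative[symmetric]
      by (auto intro!: derivative_eq_intros simp: algebra_simps power2_eq_square)
  qed
  then show ?thesis
    by (simp add: G_def algebra_simps diff_divide_distrib)
qed

text \<open>One formula serves all four overlapping cases: the kinks of the translated tent lie at
  \<open>q\<close> plus multiples of \<open>h\<close>, and only \<open>q - h\<close> and
  \<open>q\<close> can fall inside \<open>(-h, h)\<close>. The piece on \<open>[q - h, q]\<close> is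
  integrated in two parts because the fixed tent has its kink at 0.\<close>

lemma has_integral_tent_mult_piecewise_affine:
  fixes f :: "real \<Rightarrow> real"
  defines "J \<equiv> \<lambda>a b c e u v :: real.
    a * c * (v - u) + (a * e + b * c) * (v\<^sup>2 - u\<^sup>2) / 2 + b * e * (v^3 - u^3) / 3"
  assumes h: "h > 0" and q: "0 \<le> q" "q \<le> h"
    and f1: "\<And>y. -h \<le> y \<Longrightarrow> y \<le> q - h \<Longrightarrow> f y = a1 + b1 * y"
    and f2: "\<And>y. q - h \<le> y \<Longrightarrow> y \<le> q \<Longrightarrow> f y = a2 + b2 * y"
    and f3: "\<And>y. q \<le> y \<Longrightarrow> y \<le> h \<Longrightarrow> f y = a3 + b3 * y"
  shows "((\<lambda>y. tent (y / h) * f y) has_integral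
    J 1 (1 / h) a1 b1 (- h) (q - h) + J 1 (1 / h) a2 b2 (q - h) 0 +
    J 1 (- 1 / h) a2 b2 0 q + J 1 (- 1 / h) a3 b3 q h) {- h..h}"
proof -
  have neg: "tent (y / h) = 1 + 1 / h * y" if "- h \<le> y" "y \<le> 0" for y
    using that h by (simp add: tent_def divide_simps)
  have pos: "tent (y / h) = 1 + (- 1 / h) * y" if "0 \<le> y" "y \<le> h" for y
    using that h by (simp add: tent_def divide_simps)
  have "((\<lambda>y. tent (y / h) * f y) has_integral J 1 (1 / h) a1 b1 (- h) (q - h)) {- h..q - h}"
    unfolding J_def
    by (rule has_integral_eq[OF _ has_integral_affine_product[of "-h" "q - h" 1 "1 / h" a1 b1]])
      (use q h in \<open>auto simp: neg f1\<close>)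
  then have "((\<lambda>y. tent (y / h) * f y) has_integral
      J 1 (1 / h) a1 b1 (- h) (q - h) + J 1 (1 / h) a2 b2 (q - h) 0) {- h..0}"
  proof (rule has_integral_combine[rotated 2])
    show "((\<lambda>y. tent (y / h) * f y) has_integral J 1 (1 / h) a2 b2 (q - h) 0) {q - h..0}"
      unfolding J_def
      by (rule has_integral_eq[OF _ has_integral_affine_product[of "q - h" 0 1 "1 / h" a2 b2]])
        (use q h in \<open>auto simp: neg f2\<close>)
  qed (use q h in auto)
  then have "((\<lambda>y. tent (y / h) * f y) has_integral
      J 1 (1 / h) a1 b1 (- h) (q - h) + J 1 (1 / h) a2 b2 (q - h) 0 +
      J 1 (- 1 / h) a2 b2 0 q) {- h..q}"
  proof (rule has_integral_combine[rotated 2])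
    show "((\<lambda>y. tent (y / h) * f y) has_integral J 1 (- 1 / h) a2 b2 0 q) {0..q}"
      unfolding J_def
      by (rule has_integral_eq[OF _ has_integral_affine_product[of 0 q 1 "- 1 / h" a2 b2]])
        (use q h in \<open>auto simp: pos f2\<close>)
  qed (use q h in auto)
  then show ?thesis
  proof (rule has_integral_combine[rotated 2])
    show "((\<lambda>y. tent (y / h) * f y) has_integral J 1 (- 1 / h) a3 b3 q h) {q..h}"
      unfolding J_def
      by (rule has_integral_eq[OF _ has_integral_affine_product[of q h 1 "- 1 / h" a3 b3]])
        (use q h in \<open>auto simp: pos f3\<close>)
  qed (use q h in auto)
qed

section \<open>Index relations and evaluation of the five cases\<close>

text \<open>Modulo 1 all offsets agree. Modulo 2 the offsets 0 and 1 cover both parities, and each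
  has a duplicate, -2 or -1. Modulo 3 only -2 and 1 clash.\<close>

lemma cases_exclusive_imp:
  assumes excl: "cases_exclusive n k l" and k: "k \<in> {1..n}"
  shows "3 \<le> n"
    and "d \<in> {-2, 1} \<Longrightarrow> [int l = int k + d] (mod int n) \<Longrightarrow> 4 \<le> n"
proof -
  have uniq: "d = e"
    if "d \<in> {-2, -1, 0, 1}" "[int l = int k + d] (mod int n)"
      "e \<in> {-2, -1, 0, 1}" "[int l = int k + e] (mod int n)" for d e
    using excl that unfolding cases_exclusive_def Uniq_def by blast
  have cong: "[int l = int k + e] (mod int n)"
    if "[int l = int k + d] (mod int n)" "int n dvd d - e" for d e
    using that by (metis add_diff_cancel_left cong_iff_dvd_diff cong_trans)
  show 3: "3 \<le> n"
  proof (rule ccontr)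
    assume "\<not> 3 \<le> n"
    then have "n = 1 \<or> n = 2" using k by auto
    then show False
    proof
      assume "n = 1"
      then show False using uniq[of 0 1] by (simp add: cong_def)
    next
      assume n: "n = 2"
      have "[int l = int k + 0] (mod int n) \<or> [int l = int k + 1] (mod int n)"
        unfolding n cong_def by simp presburger
      then show False
        using cong[of 0 "-2"] cong[of 1 "-1"] uniq[of 0 "-2"] uniq[of 1 "-1"] n by auto
    qed
  qed
  show "4 \<le> n" if "d \<in> {-2, 1}" "[int l = int k + d] (mod int n)"
  proof (rule ccontr)
    assume "\<not> 4 \<le> n"
    then have "n = 3" using 3 by simp
    then show False
      using that cong[of "-2" 1] cong[of 1 "-2"] uniq[of "-2" 1] by auto
  qed
qed

text \<open>The translated argument is at most \<open>2 * h\<close> in absolute value for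
  \<open>d\<close> in \<open>{-1, 0}\<close> and at most \<open>3 * h\<close> for \<open>d\<close>
  in \<open>{-2, 1}\<close>. The window \<open>1 - h\<close> accommodates this for
  \<open>n >= 3\<close> and \<open>n >= 4\<close> respectively.\<close>

lemma ptent_eq_tent_near:
  assumes n: "3 \<le> n" and d: "d \<in> {-2, -1, 0, 1}" "d \<in> {-2, 1} \<Longrightarrow> 4 \<le> n"
    and h: "h = 1 / real n" and q: "q \<in> {0..<h}" and y: "y \<in> {- h..h}"
  shows "ptent n (y - q - of_int d / real n) = tent ((y - q) / h - of_int d)"
proof -
  have h0: "0 < h" "h \<le> 1 / 3" using n by (auto simp: h field_simps)
  have h4: "h \<le> 1 / 4" if "d \<in> {-2, 1}"
    using d(2)[OF that] by (auto simp: h field_simps)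
  have "\<bar>y - q - of_int d * h\<bar> \<le> 1 - h"
    using d(1) h0 h4 q y by (auto simp: abs_le_iff)
  then have "ptent n (y - q - of_int d / real n) = tent (real n * (y - q - of_int d / real n))"
    using n by (intro ptent_eq_tent) (auto simp: h)
  also have "real n * (y - q - of_int d / real n) = (y - q) / h - of_int d"
    using n by (simp add: h field_simps)
  finally show ?thesis .
qed

text \<open>Stated for every \<open>q\<close> in \<open>[0, h)\<close> and not just for one shift,
  so that the formulas can be differentiated in \<open>q\<close>.\<close>

lemma
  assumes excl: "cases_exclusive n k l" and k: "k \<in> {1..n}" and l: "l \<in> {1..n}"
    and h: "h = 1 / real n" and q: "q \<in> {0..<h}"
  shows inner_hat_shift_hat_same: "[int l = int k] (mod int n) \<Longrightarrow>
      inner (hat n k) (shift q (hat n l)) =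
      1 / h^2 * (2/3 * (h - q)^3 + q * (h - q)^2 + q * h * (h - q) + 1/6 * q^3)"
    and inner_hat_shift_hat_next: "[int l = int k + 1] (mod int n) \<Longrightarrow>
      inner (hat n k) (shift q (hat n l)) = 1 / (6 * h^2) * (h - q)^3"
    and inner_hat_shift_hat_prev: "[int l = int k - 1] (mod int n) \<Longrightarrow>
      inner (hat n k) (shift q (hat n l)) =
      1 / h^2 * (1/6 * (h - q)^3 - 1/3 * q^3 + h^2 * q)"
    and inner_hat_shift_hat_prev2: "[int l = int k - 2] (mod int n) \<Longrightarrow>
      inner (hat n k) (shift q (hat n l)) = 1 / (6 * h^2) * q^3"
proof -
  note n = cases_exclusive_imp[OF excl k]
  have h0: "h > 0" using n(1) by (simp add: h)
  have q': "0 \<le> q" "q \<le> h" using q by auto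
  have eq: "inner (hat n k) (shift q (hat n l)) = I"
    if d: "[int l = int k + d] (mod int n)" "d \<in> {-2, -1, 0, 1}"
      and I: "((\<lambda>y. tent (y / h) * tent ((y - q) / h - of_int d)) has_integral I) {- h..h}"
    for d I
  proof -
    have "inner (hat n k) (shift q (hat n l)) = integral {- h..h}
        (\<lambda>y. tent (real n * y) * ptent n (y - q - of_int d / real n))"
      using inner_hat_shift_hat[OF n(1) k l d(1)] by (simp add: h)
    also have "\<dots> = integral {- h..h} (\<lambda>y. tent (y / h) * tent ((y - q) / h - of_int d))"
      using ptent_eq_tent_near[OF n(1) d(2) n(2)[OF _ d(1)] h q]
      by (intro integral_cong) (simp add: h mult.commute)
    also have "\<dots> = I" using I by (rule integral_unique)
    finally show ?thesis .
  qed
  \<comment> \<open>The coefficients supplied below are the affine pieces of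
    \<open>tent ((y - q) / h - of_int d)\<close> on \<open>[-h, q - h]\<close>,
    \<open>[q - h, q]\<close> and \<open>[q, h]\<close>. A rational identity in \<open>q\<close> and
    \<open>h\<close> then remains.\<close>
  note pw = has_integral_tent_mult_piecewise_affine[OF h0 q']
  {
    assume "[int l = int k] (mod int n)"
    then show "inner (hat n k) (shift q (hat n l)) =
      1 / h^2 * (2/3 * (h - q)^3 + q * (h - q)^2 + q * h * (h - q) + 1/6 * q^3)"
      by (intro eq[of 0] has_integral_eq_rhs[OF
        pw[where ?a1.0 = 0 and ?b1.0 = 0 and ?a2.0 = "1 - q / h" and ?b2.0 = "1 / h"
          and ?a3.0 = "1 + q / h" and ?b3.0 = "- 1 / h"]])
        (use h0 q' in \<open>auto simp: tent_def field_simps eval_nat_numeral\<close>)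
  next
    assume "[int l = int k + 1] (mod int n)"
    then show "inner (hat n k) (shift q (hat n l)) = 1 / (6 * h^2) * (h - q)^3"
      by (intro eq[of 1] has_integral_eq_rhs[OF
        pw[where ?a1.0 = 0 and ?b1.0 = 0 and ?a2.0 = 0 and ?b2.0 = 0
          and ?a3.0 = "- q / h" and ?b3.0 = "1 / h"]])
        (use h0 q' in \<open>auto simp: tent_def field_simps eval_nat_numeral\<close>)
  next
    assume "[int l = int k - 1] (mod int n)"
    then show "inner (hat n k) (shift q (hat n l)) =
      1 / h^2 * (1/6 * (h - q)^3 - 1/3 * q^3 + h^2 * q)"
      by (intro eq[of "-1"] has_integral_eq_rhs[OF
        pw[where ?a1.0 = "2 - q / h" and ?b1.0 = "1 / h" and ?a2.0 = "q / h" and ?b2.0 = "- 1 / h"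
          and ?a3.0 = 0 and ?b3.0 = 0]])
        (use h0 q' in \<open>auto simp: tent_def field_simps eval_nat_numeral\<close>)
  next
    assume "[int l = int k - 2] (mod int n)"
    then show "inner (hat n k) (shift q (hat n l)) = 1 / (6 * h^2) * q^3"
      by (intro eq[of "-2"] has_integral_eq_rhs[OF
        pw[where ?a1.0 = "- 1 + q / h" and ?b1.0 = "- 1 / h" and ?a2.0 = 0 and ?b2.0 = 0
          and ?a3.0 = 0 and ?b3.0 = 0]])
        (use h0 q' in \<open>auto simp: tent_def field_simps eval_nat_numeral\<close>)
  }
qed

text \<open>The residue \<open>d\<close> of \<open>l - k\<close> in \<open>[0, n)\<close> avoids 0,
  1, \<open>n - 2\<close> and \<open>n - 1\<close>, so \<open>2 <= d <= n - 3\<close>. Then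
  \<open>y - q - d * h\<close> lies between \<open>h - 1\<close> and \<open>-h\<close>, in the gap
  between two hats.\<close>

lemma inner_hat_shift_hat_far:
  assumes n: "3 \<le> n" and k: "k \<in> {1..n}" and l: "l \<in> {1..n}"
    and h: "h = 1 / real n" and q: "q \<in> {0..<h}"
    and far: "\<And>d. d \<in> {-2, -1, 0, 1} \<Longrightarrow> \<not> [int l = int k + d] (mod int n)"
  shows "inner (hat n k) (shift q (hat n l)) = 0"
proof -
  define d where "d = (int l - int k) mod int n"
  have cong: "[int l = int k + d] (mod int n)"
    by (simp add: cong_def d_def mod_add_right_eq)
  \<comment> \<open>The negative representative \<open>d - n\<close> is the one to compare with the
    offsets -2 and -1.\<close>
  have cong': "[int l = int k + (d - int n)] (mod int n)"
    using cong by (simp add: cong_def mod_diff_right_eq flip: add_diff_eq) (metis add_diff_eq minus_mod_self2)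
  have "0 \<le> d" "d < int n" using n by (auto simp: d_def)
  moreover have "d \<notin> {0, 1}" "d - int n \<notin> {-2, -1}"
    using far cong cong' by blast+
  ultimately have "2 \<le> d" "d \<le> int n - 3" by auto
  then have "2 * h \<le> of_int d * h" "of_int d * h \<le> (real n - 3) * h"
    using n by (intro mult_right_mono; simp add: h)+
  moreover have "(real n - 3) * h = 1 - 3 * h" using n by (simp add: h field_simps)
  ultimately have dh: "2 * h \<le> of_int d / real n" "of_int d / real n \<le> 1 - 3 * h"
    by (simp_all add: h)
  have "ptent n (y - q - of_int d / real n) = 0" if "y \<in> {- h..h}" for y
    using that dh q n by (intro ptent_eq_0) (auto simp flip: h)
  then have "integral {- h..h} (\<lambda>y. tent (real n * y) * ptent n (y - q - of_int d / real n))
      = integral {- h..h} (\<lambda>y. 0)"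
    by (intro integral_cong) simp
  then show ?thesis
    using inner_hat_shift_hat[OF n k l cong] by (simp add: h)
qed

section \<open>Differentiating the inner product formulas\<close>

text \<open>At \<open>p = a\<close> the formula \<open>E\<close> is known only to the right of
  \<open>p\<close>. As the derivatives of \<open>f\<close> and \<open>E\<close> exist, comparing
  them within a right neighbourhood determines the value.\<close>

lemma inner_vector_derivative_eq:
  fixes f :: "real \<Rightarrow> 'a::real_inner"
  assumes f: "f differentiable (at p)" and p: "p \<in> {a..<b}"
    and E: "\<And>q. q \<in> {a..<b} \<Longrightarrow> inner v (f q) = E q"
    and E': "(E has_real_derivative E') (at p)"
  shows "inner v (vector_derivative f (at p)) = E'"
proof -
  \<comment> \<open>The midpoint makes \<open>{p..c}\<close> nondegenerate and keeps it inside
    \<open>{a..<b}\<close>.\<close>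
  define c where "c = (p + b) / 2"
  have "((\<lambda>q. inner v (f q)) has_vector_derivative inner v (vector_derivative f (at p))) (at p)"
    using f by (intro bounded_linear.has_vector_derivative[OF bounded_linear_inner_right])
      (simp add: vector_derivative_works)
  then have "((\<lambda>q. inner v (f q)) has_vector_derivative inner v (vector_derivative f (at p)))
      (at p within {p..c})"
    by (rule has_vector_derivative_at_within)
  then have "(E has_vector_derivative inner v (vector_derivative f (at p))) (at p within {p..c})"
    by (rule has_vector_derivative_transform[rotated 2]) (use p E in \<open>auto simp: c_def field_simps\<close>)
  moreover have "(E has_vector_derivative E') (at p within {p..c})"
    using E' by (simp add: has_real_derivative_iff_has_vector_derivative has_vector_derivative_at_within)
  moreover have "at p within {p..c} \<noteq> bot"
    using p by (simp add: at_within_Icc_at_right c_def)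
  ultimately show ?thesis by (rule vector_derivative_unique_within[rotated])
qed

theorem lemma2:
  fixes n k l :: nat and h p :: real
  assumes h: "h = 1 / real n"
    and k: "k \<in> {1..n}" and l: "l \<in> {1..n}"
    and p: "p \<in> {0..<h}"
    and excl: "cases_exclusive n k l"
  shows "inner (hat n k) (shift p (hat n l)) =
      (if [int l = int k] (mod int n) then
         1 / h^2 * (2/3 * (h - p)^3 + p * (h - p)^2 + p * h * (h - p) + 1/6 * p^3)
       else if [int l = int k + 1] (mod int n) then 1 / (6 * h^2) * (h - p)^3
       else if [int l = int k - 1] (mod int n) then
         1 / h^2 * (1/6 * (h - p)^3 - 1/3 * p^3 + h^2 * p)
       else if [int l = int k - 2] (mod int n) then 1 / (6 * h^2) * p^3
       else 0) \<and>
    (\<lambda>q. shift q (hat n l)) differentiable (at p) \<and>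
    inner (hat n k) (vector_derivative (\<lambda>q. shift q (hat n l)) (at p)) =
      (if [int l = int k] (mod int n) then - (1 / h^2) * (2 * p * h - 3/2 * p^2)
       else if [int l = int k + 1] (mod int n) then - (1 / (2 * h^2)) * (h - p)^2
       else if [int l = int k - 1] (mod int n) then
         - (1 / h^2) * (2 * p^2 - 2 * h * p - 1/2 * (h - p)^2)
       else if [int l = int k - 2] (mod int n) then 1 / (2 * h^2) * p^2
       else 0)"
proof -
  note n = cases_exclusive_imp(1)[OF excl k]
  have h0: "h > 0" using n by (simp add: h)
  note diff = shift_hat_differentiable[OF n l]
  \<comment> \<open>In each case below it remains to differentiate the closed formula in
    \<open>q\<close>, a polynomial for fixed \<open>h\<close>.\<close>
  note deriv = inner_vector_derivative_eq[OF diff p]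
  consider (same) "[int l = int k] (mod int n)"
    | (nxt) "\<not> [int l = int k] (mod int n)" "[int l = int k + 1] (mod int n)"
    | (prev) "\<not> [int l = int k] (mod int n)" "\<not> [int l = int k + 1] (mod int n)"
        "[int l = int k - 1] (mod int n)"
    | (prev2) "\<not> [int l = int k] (mod int n)" "\<not> [int l = int k + 1] (mod int n)"
        "\<not> [int l = int k - 1] (mod int n)" "[int l = int k - 2] (mod int n)"
    | (far) "\<not> [int l = int k] (mod int n)" "\<not> [int l = int k + 1] (mod int n)"
        "\<not> [int l = int k - 1] (mod int n)" "\<not> [int l = int k - 2] (mod int n)"
    by blast
  then show ?thesis
  proof cases
    case same
    note E = inner_hat_shift_hat_same[OF excl k l h _ same]
    have "inner (hat n k) (vector_derivative (\<lambda>q. shift q (hat n l)) (at p)) =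
        - (1 / h^2) * (2 * p * h - 3/2 * p^2)"
      by (rule deriv[OF E]) (use h0 in \<open>auto intro!: derivative_eq_intros
        simp: field_simps eval_nat_numeral\<close>)
    with same show ?thesis using E[OF p] diff by simp
  next
    case nxt
    note E = inner_hat_shift_hat_next[OF excl k l h _ nxt(2)]
    have "inner (hat n k) (vector_derivative (\<lambda>q. shift q (hat n l)) (at p)) =
        - (1 / (2 * h^2)) * (h - p)^2"
      by (rule deriv[OF E]) (use h0 in \<open>auto intro!: derivative_eq_intros
        simp: field_simps eval_nat_numeral\<close>)
    with nxt show ?thesis using E[OF p] diff by simp
  next
    case prev
    note E = inner_hat_shift_hat_prev[OF excl k l h _ prev(3)]
    have "inner (hat n k) (vector_derivative (\<lambda>q. shift q (hat n l)) (at p)) =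
        - (1 / h^2) * (2 * p^2 - 2 * h * p - 1/2 * (h - p)^2)"
      by (rule deriv[OF E]) (use h0 in \<open>auto intro!: derivative_eq_intros
        simp: field_simps eval_nat_numeral\<close>)
    with prev show ?thesis using E[OF p] diff by simp
  next
    case prev2
    note E = inner_hat_shift_hat_prev2[OF excl k l h _ prev2(4)]
    have "inner (hat n k) (vector_derivative (\<lambda>q. shift q (hat n l)) (at p)) =
        1 / (2 * h^2) * p^2"
      by (rule deriv[OF E]) (use h0 in \<open>auto intro!: derivative_eq_intros
        simp: field_simps eval_nat_numeral\<close>)
    with prev2 show ?thesis using E[OF p] diff by simp
  next
    case far
    have E: "inner (hat n k) (shift q (hat n l)) = 0" if "q \<in> {0..<h}" for q
      using far by (intro inner_hat_shift_hat_far[OF n k l h that]) auto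
    have "inner (hat n k) (vector_derivative (\<lambda>q. shift q (hat n l)) (at p)) = 0"
      by (rule deriv[OF E]) auto
    with far show ?thesis using E[OF p] diff by simp
  qed
qed

end
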